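(* Let $p$ be an odd prime, let $u\in\mathbb{F}_{p^2}^*$ be a primitive element, and let $k,\ell\in\{0,\dots,p-1\}$ with $k+\ell$ odd. Then the function \[G_{k,\ell}\colon\mathbb{F}_{p^2}\to\mathbb{F}_{p^2},\quad X\mapsto X^{2p-1}+u\cdot X^{kp+\ell}\] is GAPN and of algebraic degree $\max\{p,k+\ell\}$.
   Context: $\mathbb{F}_{p^n}$ denotes the finite field with $p^n$ elements and $\mathbb{F}_{p^n}^*$ its multiplicative group; a primitive element of $\mathbb{F}_{p^2}^*$ is a generator of this cyclic group. A function $G\colon\mathbb{F}_{p^n}\to\mathbb{F}_{p^n}$ is GAPN (generalized almost perfect nonlinear) if for all $a\in\mathbb{F}_{p^n}^*$ and $b\in\mathbb{F}_{p^n}$ the equation $\sum_{i\in\mathbb{F}_p}G(X+ia)=b$ has at most $p$ solutions $X\in\mathbb{F}_{p^n}$. For a non-negative integer $m$ with base-$p$ representation $m=\sum_{i\ge 0}h_ip^i$, put $d_p(m)=\sum_{i\ge0}h_i$. The algebraic degree of a nonzero function $G(X)=\sum_{m=0}^{p^n-1}a_mX^m$ (the unique such representation of degree at most $p^n-1$, with $a_m\in\mathbb{F}_{p^n}$) is the maximum of $d_p(m)$ over all $m\in\{0,\dots,p^n-1\}$ with $a_m\ne0$. *)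

theory Defs
  imports
    "HOL-Computational_Algebra.Computational_Algebra"
    "HOL-Number_Theory.Cong"
    "HOL-Library.Cardinality"
begin

text \<open>
  The field with \<open>p ^ n\<close> elements is an arbitrary type of class \<open>finite_field\<close> with
  \<open>p ^ n\<close> elements. The definitions below refer to \<open>p\<close> as the characteristic, justified by:
\<close>

lemma CHAR_finite_field_eqI:
  assumes "prime p" and "CARD('a::finite_field) = p ^ n"
  shows "CHAR('a) = p"
proof -
  have "(of_nat CARD('a) :: 'a) = 0"
  proof -
    have "bij_betw (\<lambda>x::'a. x + 1) UNIV UNIV"
      by (rule bij_betwI[where g = "\<lambda>x. x - 1"]) auto
    from sum.reindex_bij_betw[OF this, of "\<lambda>x. x"]
    have "(\<Sum>x\<in>UNIV. x + 1 :: 'a) = (\<Sum>x\<in>UNIV. x)" .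
    thus ?thesis by (simp add: sum.distrib)
  qed
  hence "CHAR('a) dvd p ^ n"
    by (simp only: of_nat_eq_0_iff_char_dvd assms(2))
  moreover have "prime CHAR('a)" by simp
  ultimately show ?thesis
    using assms(1) by (metis prime_dvd_power primes_dvd_imp_eq)
qed

text \<open>In characteristic \<open>p\<close>, the set \<open>\<int>\<close> (the image of \<open>of_int\<close>) is the prime field.\<close>

lemma card_Ints_finite_field: "card (\<int> :: 'a::finite_field set) = CHAR('a)"
proof -
  have "(\<int> :: 'a set) = of_nat ` {..<CHAR('a)}"
  proof (intro equalityI subsetI)
    fix x :: 'a assume "x \<in> \<int>"
    then obtain i where i: "x = of_int i" by (elim Ints_cases)
    define j where "j = nat (i mod int CHAR('a))"
    have j: "int j = i mod int CHAR('a)" "j < CHAR('a)"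
      by (simp_all add: j_def nat_less_iff)
    have "x = of_int (int CHAR('a) * (i div int CHAR('a)) + int j)"
      by (simp add: i j)
    also have "\<dots> = of_nat j"
      by (simp only: of_int_add of_int_mult of_int_of_nat_eq of_nat_CHAR) simp
    finally show "x \<in> of_nat ` {..<CHAR('a)}" using j(2) by blast
  qed auto
  moreover have "inj_on (of_nat :: nat \<Rightarrow> 'a) {..<CHAR('a)}"
    by (intro inj_onI) (auto simp: of_nat_eq_iff_cong_CHAR cong_def)
  ultimately show ?thesis by (metis card_image card_lessThan)
qed

definition primitive_element :: "'a::finite_field \<Rightarrow> bool" where
  "primitive_element u \<longleftrightarrow> u \<noteq> 0 \<and> (\<forall>x. x \<noteq> 0 \<longrightarrow> (\<exists>i::int. x = u powi i))"

definition gapn :: "('a::finite_field \<Rightarrow> 'a) \<Rightarrow> bool" where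
  "gapn G \<longleftrightarrow>
     (\<forall>a b. a \<noteq> 0 \<longrightarrow> card {X. (\<Sum>i\<in>\<int>. G (X + i * a)) = b} \<le> CHAR('a))"

text \<open>\<open>m div p ^ i mod p\<close> is the \<open>i\<close>-th base-\<open>p\<close> digit of \<open>m\<close>. Only
  finitely many of them are nonzero, so the series below is a finite sum.\<close>

definition digit_sum :: "nat \<Rightarrow> nat \<Rightarrow> nat" where
  "digit_sum p m = (\<Sum>i. m div p ^ i mod p)"

lemma digit_sum_eq:
  assumes "p \<ge> 2"
  shows "digit_sum p m = (\<Sum>i<m. m div p ^ i mod p)"
  unfolding digit_sum_def
proof (rule suminf_finite)
  fix i assume "i \<notin> {..<m}"
  moreover have "i < p ^ i" using assms by (intro power_gt_expt) simp
  ultimately show "m div p ^ i mod p = 0" by simp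
qed simp

definition repr_poly :: "('a::finite_field \<Rightarrow> 'a) \<Rightarrow> 'a poly" where
  "repr_poly G = (THE P. degree P \<le> CARD('a) - 1 \<and> (\<forall>x. G x = poly P x))"

lemma repr_poly_ex1:
  fixes G :: "'a::finite_field \<Rightarrow> 'a"
  shows "\<exists>!P. degree P \<le> CARD('a) - 1 \<and> (\<forall>x. G x = poly P x)"
proof (rule ex_ex1I)
  define q where "q = CARD('a)"
  have q: "q \<ge> 2"
    using card_mono[of UNIV "{0, 1 :: 'a}"] by (simp add: q_def)
  have pow: "x ^ (q - 1) = 1" if "x \<noteq> 0" for x :: 'a
  proof -
    have "x * x ^ (q - 1) = x * 1"
      using finite_field_power_card_eq_same[of x] q
      by (simp add: q_def flip: power_Suc)
    thus ?thesis using that by simp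
  qed
  define P where "P = (\<Sum>a\<in>UNIV. smult (G a) (1 - [:-a, 1:] ^ (q - 1)))"
  have "degree P \<le> q - 1"
    unfolding P_def
    by (intro degree_sum_le order.trans[OF degree_smult_le] degree_diff_le)
       (auto intro!: order.trans[OF degree_power_le])
  moreover have "poly P x = G x" for x
  proof -
    have "poly P x = (\<Sum>a\<in>UNIV. if a = x then G a else 0)"
      unfolding P_def poly_sum using pow q by (intro sum.cong) auto
    thus ?thesis by simp
  qed
  ultimately show "\<exists>P. degree P \<le> CARD('a) - 1 \<and> (\<forall>x. G x = poly P x)"
    unfolding q_def by (intro exI[of _ P]) auto
next
  fix P Q assume "degree P \<le> CARD('a) - 1 \<and> (\<forall>x. G x = poly P x)"
    and "degree Q \<le> CARD('a) - 1 \<and> (\<forall>x. G x = poly Q x)"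
  moreover have "CARD('a) > 0" by simp
  ultimately show "P = Q"
    by (intro poly_eqI_degree[of UNIV]) (auto simp del: zero_less_card_finite)
qed

text \<open>Only meaningful for nonzero \<open>G\<close>: otherwise the maximum ranges over the empty set.\<close>

definition algebraic_degree :: "('a::finite_field \<Rightarrow> 'a) \<Rightarrow> nat" where
  "algebraic_degree G =
     Max (digit_sum CHAR('a) ` {m \<in> {0..CARD('a) - 1}. coeff (repr_poly G) m \<noteq> 0})"

end

theory Submission
  imports Defs
begin

text \<open>
  Put \<open>t = Z\<^sup>p - Z\<close>. Since \<open>(Z + i)\<^sup>p = (Z + i) + t\<close> for \<open>i\<close> in the prime field, expanding
  in powers of \<open>t\<close> and evaluating power sums gives
  \<open>(\<Sum>i. (Z + i) ^ (k * p + l)) = c * t ^ e\<close> with \<open>c\<close> in the prime field and, unless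
  \<open>c = 0\<close>, \<open>e = k + l - (p - 1)\<close>, which is odd; for \<open>2 * p - 1 = 1 * p + (p - 1)\<close> the sum is \<open>- t\<close>. In the field with
  \<open>p\<^sup>2\<close> elements \<open>t\<^sup>p = - t\<close>, so two different values \<open>s\<close>, \<open>t\<close> of this form satisfy
  \<open>((t ^ e - s ^ e) / (t - s)) ^ p = (t ^ e - s ^ e) / (t - s)\<close>. If two solutions \<open>X = a * Z\<close> of the
  GAPN equation had different \<open>t\<close>, then \<open>a ^ (2 * p - 1) = u * a ^ (k * p + l) * g\<close> with \<open>g\<close> in the
  prime field. Both exponents of \<open>a\<close> are odd and \<open>g\<close> is a square, so \<open>u\<close> would be a
  square, which a primitive element is not.
\<close>

section \<open>Counting roots of \<open>X ^ n - 1\<close> and \<open>X ^ n - X\<close>\<close>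

lemma card_power_eq_one_le:
  fixes A :: "'a::field set"
  assumes "n > 0" and "\<And>x. x \<in> A \<Longrightarrow> x ^ n = 1"
  shows "card A \<le> n"
proof -
  let ?P = "monom 1 n - 1 :: 'a poly"
  have deg: "degree ?P \<le> n"
    by (intro degree_diff_le degree_monom_le) simp
  have "coeff ?P n = 1" using assms(1) by simp
  hence nz: "?P \<noteq> 0" by force
  have "card A \<le> card {x. poly ?P x = 0}"
    using assms(2) nz by (intro card_mono poly_roots_finite) (auto simp: poly_monom)
  also have "\<dots> \<le> degree ?P" using nz by (rule card_poly_roots_bound)
  finally show ?thesis using deg by simp
qed

lemma power_eq_self_iff:
  fixes x :: "'a::field"
  assumes "x \<noteq> 0" and "n > 0"
  shows "x ^ n = x \<longleftrightarrow> x ^ (n - 1) = 1"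
  using assms by (cases n) auto

lemma card_power_eq_self_le:
  fixes n :: nat
  assumes "n \<ge> 2"
  shows "card {x::'a::field. x ^ n = x} \<le> n"
proof -
  let ?A = "{x::'a. x ^ (n - 1) = 1}"
  have "x \<in> insert 0 ?A" if "x ^ n = x" for x :: 'a
    using that assms power_eq_self_iff[of x n] by (cases "x = 0") simp_all
  moreover have "x ^ n = x" if "x \<in> insert 0 ?A" for x :: 'a
    using that assms power_eq_self_iff[of x n] by (cases "x = 0") simp_all
  ultimately have "{x::'a. x ^ n = x} = insert 0 ?A" by blast
  moreover have "card ?A \<le> n - 1"
    using assms by (intro card_power_eq_one_le) simp_all
  ultimately show ?thesis
    using assms card_insert_le_m1[of n ?A 0] by (metis less_le_trans zero_less_numeral)
qed

section \<open>Frobenius and the prime field\<close>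

lemma freshmans_dream_diff:
  fixes x y :: "'a::comm_ring_1"
  assumes "prime CHAR('a)" and "n = CHAR('a)"
  shows "(x - y) ^ n = x ^ n - y ^ n"
  using freshmans_dream[of n "x - y" y] assms by (simp add: eq_diff_eq)

lemma Ints_power_CHAR:
  fixes x :: "'a::finite_field"
  assumes "x \<in> \<int>"
  shows "x ^ CHAR('a) = x"
  using assms
proof (induction rule: Ints_induct)
  case (of_int z)
  show ?case
  proof (induction z rule: int_induct[where k = 0])
    case (step1 i)
    thus ?case by (simp add: freshmans_dream)
  next
    case (step2 i)
    thus ?case by (simp add: freshmans_dream_diff)
  qed simp
qed

lemma Ints_power_CHAR_minus_1:
  fixes x :: "'a::finite_field"
  assumes "x \<in> \<int>" and "x \<noteq> 0"
  shows "x ^ (CHAR('a) - 1) = 1"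
  using Ints_power_CHAR[OF assms(1)] assms(2) by (simp add: power_eq_self_iff)

section \<open>Power sums over translates of the prime field\<close>

text \<open>For \<open>m > 0\<close>, \<open>X ^ m - 1\<close> has too few roots to vanish at every
  nonzero element of the prime field. Scaling by a \<open>g\<close> with
  \<open>g ^ m \<noteq> 1\<close> permutes that field, so the sum equals \<open>g ^ m\<close> times
  itself.\<close>

lemma sum_power_Ints_eq_0:
  fixes m :: nat
  assumes "m < CHAR('a::finite_field) - 1"
  shows "(\<Sum>i\<in>\<int>. i ^ m) = (0::'a)"
proof (cases "m = 0")
  case True
  thus ?thesis by (simp add: card_Ints_finite_field)
next
  case False
  have "\<not> (\<forall>g\<in>\<int> - {0::'a}. g ^ m = 1)"
  proof
    assume "\<forall>g\<in>\<int> - {0::'a}. g ^ m = 1"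
    hence "card (\<int> - {0::'a}) \<le> m"
      using False by (intro card_power_eq_one_le) auto
    thus False using assms by (simp add: card_Ints_finite_field)
  qed
  then obtain g :: 'a where g: "g \<in> \<int>" "g \<noteq> 0" "g ^ m \<noteq> 1" by blast
  have "inj_on (\<lambda>i. g * i) (\<int>::'a set)" using g(2) by (auto intro: inj_onI)
  moreover have "(\<lambda>i. g * i) ` (\<int>::'a set) \<subseteq> \<int>" using g(1) by auto
  ultimately have "bij_betw (\<lambda>i. g * i) (\<int>::'a set) \<int>"
    by (simp add: bij_betw_def endo_inj_surj)
  from sum.reindex_bij_betw[OF this, of "\<lambda>i. i ^ m"]
  have "g ^ m * (\<Sum>i\<in>\<int>. i ^ m) = (\<Sum>i\<in>\<int>. i ^ m)"
    by (simp add: power_mult_distrib sum_distrib_left)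
  thus ?thesis using g(3) by simp
qed

lemma sum_power_Ints_CHAR_minus_1:
  "(\<Sum>i\<in>\<int>. i ^ (CHAR('a) - 1)) = (- 1 :: 'a::finite_field)"
proof -
  have gt: "CHAR('a) > 1" using prime_gt_1_nat[of "CHAR('a)"] by simp
  have "(\<Sum>i\<in>\<int>. i ^ (CHAR('a) - 1)) = (\<Sum>i\<in>\<int> - {0::'a}. i ^ (CHAR('a) - 1))"
    using gt by (intro sum.mono_neutral_right) auto
  also have "\<dots> = (\<Sum>i\<in>\<int> - {0::'a}. 1)"
    using Ints_power_CHAR_minus_1 by (intro sum.cong) auto
  also have "\<dots> = - 1"
    using gt by (simp add: card_Ints_finite_field of_nat_diff)
  finally show ?thesis .
qed

text \<open>After binomial expansion only the power sum with exponent \<open>CHAR('a) - 1\<close>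
  survives; it occurs only as the top term, whose power of \<open>Z\<close> is 1.\<close>

lemma sum_power_shift_Ints_low:
  fixes Z :: "'a::finite_field"
  assumes "m < CHAR('a)"
  shows "(\<Sum>i\<in>\<int>. (Z + i) ^ m) = (if m = CHAR('a) - 1 then - 1 else 0)"
proof -
  have "(\<Sum>i\<in>\<int>. (Z + i) ^ m)
      = (\<Sum>i\<in>\<int>. \<Sum>j\<le>m. of_nat (m choose j) * i ^ j * Z ^ (m - j))"
    by (simp add: binomial_ring add.commute[of Z])
  also have "\<dots> = (\<Sum>j\<le>m. of_nat (m choose j) * (\<Sum>i\<in>\<int>. i ^ j) * Z ^ (m - j))"
    by (subst sum.swap) (simp add: sum_distrib_left sum_distrib_right)
  also have "\<dots> = (\<Sum>j\<le>m. if j = CHAR('a) - 1 then - 1 else 0)"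
  proof (intro sum.cong refl)
    fix j assume "j \<in> {..m}"
    hence "j < CHAR('a) - 1 \<or> j = CHAR('a) - 1 \<and> m = j" using assms by auto
    thus "of_nat (m choose j) * (\<Sum>i\<in>\<int>. i ^ j) * Z ^ (m - j)
        = (if j = CHAR('a) - 1 then - 1 else 0)"
      by (auto simp: sum_power_Ints_eq_0 sum_power_Ints_CHAR_minus_1 simp del: One_nat_def)
  qed
  also have "\<dots> = (if m = CHAR('a) - 1 then - 1 else 0)" using assms by auto
  finally show ?thesis .
qed

text \<open>For \<open>m = p + n\<close>, the relation \<open>(Z + i) ^ p = (Z + i) + t\<close>
  lowers the exponents to \<open>n\<close> and \<open>n + 1\<close>, both below
  \<open>p - 1\<close>. The bound is sharp: \<open>m = 2 * p - 2\<close> would give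
  \<open>n + 1 = p - 1\<close>, where the sum is \<open>- 1\<close>.\<close>

lemma sum_power_shift_Ints:
  fixes Z :: "'a::finite_field"
  assumes "m < 2 * CHAR('a) - 2"
  shows "(\<Sum>i\<in>\<int>. (Z + i) ^ m) = (if m = CHAR('a) - 1 then - 1 else 0)"
proof (cases "m < CHAR('a)")
  case False
  let ?p = "CHAR('a)"
  define n where "n = m - ?p"
  have m: "m = ?p + n" and n: "Suc n < ?p - 1" using False assms by (auto simp: n_def)
  have "(Z + i) ^ m = (Z ^ ?p - Z) * (Z + i) ^ n + (Z + i) ^ Suc n" if "i \<in> \<int>" for i
    by (simp add: m power_add freshmans_dream Ints_power_CHAR that algebra_simps)
  hence "(\<Sum>i\<in>\<int>. (Z + i) ^ m)
      = (Z ^ ?p - Z) * (\<Sum>i\<in>\<int>. (Z + i) ^ n) + (\<Sum>i\<in>\<int>. (Z + i) ^ Suc n)"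
    by (simp add: sum.distrib sum_distrib_left)
  also have "\<dots> = 0"
    using n by (subst (1 2) sum_power_shift_Ints_low) auto
  finally show ?thesis using m n by auto
qed (rule sum_power_shift_Ints_low)

lemma sum_power_two_digits_Ints:
  fixes Z :: "'a::finite_field"
  assumes "k + l < 2 * CHAR('a) - 2" and "l < CHAR('a)"
  shows "(\<Sum>i\<in>\<int>. (Z + i) ^ (k * CHAR('a) + l))
    = - of_nat (k choose (CHAR('a) - 1 - l)) * (Z ^ CHAR('a) - Z) ^ (k + l - (CHAR('a) - 1))"
proof -
  let ?p = "CHAR('a)"
  let ?t = "Z ^ ?p - Z"
  have "(Z + i) ^ (k * ?p + l)
      = (\<Sum>j\<le>k. of_nat (k choose j) * ?t ^ (k - j) * (Z + i) ^ (j + l))" if "i \<in> \<int>" for i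
  proof -
    have "(Z + i) ^ ?p = (Z + i) + ?t"
      using that by (simp add: freshmans_dream Ints_power_CHAR)
    hence "(Z + i) ^ (k * ?p + l) = ((Z + i) + ?t) ^ k * (Z + i) ^ l"
      by (metis power_add power_mult mult.commute)
    thus ?thesis
      by (simp only: binomial_ring[of "Z + i" ?t k] sum_distrib_right) (simp add: power_add mult_ac)
  qed
  hence "(\<Sum>i\<in>\<int>. (Z + i) ^ (k * ?p + l))
      = (\<Sum>i\<in>\<int>. \<Sum>j\<le>k. of_nat (k choose j) * ?t ^ (k - j) * (Z + i) ^ (j + l))"
    by (intro sum.cong) auto
  also have "\<dots> = (\<Sum>j\<le>k. of_nat (k choose j) * ?t ^ (k - j) * (\<Sum>i\<in>\<int>. (Z + i) ^ (j + l)))"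
    by (subst sum.swap) (simp add: sum_distrib_left)
  also have "\<dots> = (\<Sum>j\<le>k. if j = ?p - 1 - l then - of_nat (k choose j) * ?t ^ (k - j) else 0)"
    using assms by (intro sum.cong refl) (auto simp: sum_power_shift_Ints)
  \<comment> \<open>If the surviving index exceeds \<open>k\<close>, the sum is empty of
    contributions and the binomial coefficient is 0, so the truncated exponent is harmless.\<close>
  also have "\<dots> = - of_nat (k choose (?p - 1 - l)) * ?t ^ (k + l - (?p - 1))"
    using assms(2) by (auto simp: binomial_eq_0 Suc_diff_Suc)
  finally show ?thesis .
qed

text \<open>Otherwise every nonzero element, being a power of \<open>u\<close>, would be a root of
  \<open>X ^ n - 1\<close>, which has at most \<open>n\<close> roots.\<close>

lemma primitive_element_power_neq_1:
  fixes u :: "'a::finite_field"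
  assumes "primitive_element u" and "0 < n" and "n < CARD('a) - 1"
  shows "u ^ n \<noteq> 1"
proof
  assume un: "u ^ n = 1"
  have "x ^ n = 1" if x: "x \<noteq> 0" for x :: 'a
  proof -
    from assms(1) x obtain i where "x = u powi i"
      by (auto simp: primitive_element_def)
    hence "x ^ n = (u ^ n) powi i"
      by (metis mult.commute power_int_mult power_int_of_nat)
    thus ?thesis using un by simp
  qed
  hence "card (UNIV - {0::'a}) \<le> n"
    using assms(2) by (intro card_power_eq_one_le) auto
  thus False using assms(3) by (simp add: card_Diff_singleton)
qed

lemma finite_field_power_card_minus_1:
  fixes x :: "'a::finite_field"
  assumes "x \<noteq> 0"
  shows "x ^ (CARD('a) - 1) = 1"
  using finite_field_power_card_eq_same[of x] assms by (simp add: power_eq_self_iff)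

lemma digit_sum_two_digits:
  assumes "p \<ge> 2" and "k < p" and "l < p"
  shows "digit_sum p (k * p + l) = k + l"
proof -
  have "digit_sum p (k * p + l) = (\<Sum>i\<in>{0, 1}. (k * p + l) div p ^ i mod p)"
    unfolding digit_sum_def
  proof (rule suminf_finite)
    fix i :: nat assume "i \<notin> {0, 1}"
    hence "p ^ 2 \<le> p ^ i" using assms by (intro power_increasing) auto
    moreover have "(k + 1) * p \<le> p * p" using assms by (intro mult_right_mono) auto
    ultimately have "k * p + l < p ^ i" using assms by (simp add: power2_eq_square)
    thus "(k * p + l) div p ^ i mod p = 0" by simp
  qed simp
  thus ?thesis using assms by simp
qed

lemma repr_poly_eqI:
  fixes G :: "'a::finite_field \<Rightarrow> 'a"
  assumes "degree P \<le> CARD('a) - 1" and "\<And>x. G x = poly P x"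
  shows "repr_poly G = P"
  unfolding repr_poly_def using assms by (intro the1_equality repr_poly_ex1) auto

theorem corollary1:
  fixes u :: "'a::finite_field" and p k l :: nat
  assumes "prime p" and "odd p"
    and "CARD('a) = p ^ 2"
    and "primitive_element u"
    and "k \<in> {0..p - 1}" and "l \<in> {0..p - 1}"
    and "odd (k + l)"
  defines "G \<equiv> (\<lambda>X::'a. X ^ (2 * p - 1) + u * X ^ (k * p + l))"
  shows "gapn G \<and> algebraic_degree G = max p (k + l)"
proof -
  have char: "CHAR('a) = p"
    using assms(1,3) by (rule CHAR_finite_field_eqI)
  have p3: "p \<ge> 3"
    using assms(1,2) prime_ge_2_nat[of p] by (cases "p = 2") auto
  have kl: "k < p" "l < p" using assms(5,6) p3 by auto
  have kl_lt: "k + l < 2 * p - 2"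
  proof -
    \<comment> \<open>Parity excludes the one value of \<open>k + l\<close> outside the range of the
      power sum formula.\<close>
    have "k + l \<noteq> 2 * (p - 1)" using assms(7) by (metis even_mult_iff even_numeral)
    thus ?thesis using kl by linarith
  qed
  have even_p: "even (p - 1)" using assms(2) by simp
  have exp1: "2 * p - 1 = 1 * p + (p - 1)" using p3 by simp
  have frob_diff: "(x - y) ^ p = x ^ p - y ^ p" for x y :: 'a
    by (rule freshmans_dream_diff) (simp_all add: char assms(1))
  \<comment> \<open>Half the order of the multiplicative group, so \<open>x ^ N\<close> is the
    quadratic character. The factor \<open>p - 1\<close> makes it trivial on the prime
    field.\<close>
  define N where "N = (p - 1) * ((p + 1) div 2)"
  have NN: "N * 2 = CARD('a) - 1"
  proof -
    have "(p + 1) div 2 * 2 = p + 1" using assms(2) by presburger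
    hence "N * 2 = (p - 1) * (p + 1)" by (simp add: N_def mult.assoc)
    thus ?thesis by (simp add: assms(3) power2_eq_square algebra_simps)
  qed
  have N0: "0 < N" using p3 by (simp add: N_def)
  have N: "N < CARD('a) - 1" using NN N0 by linarith
  have uN: "u ^ N \<noteq> 1"
    using assms(4) N0 N by (rule primitive_element_power_neq_1)
  have u0: "u \<noteq> 0" using assms(4) by (simp add: primitive_element_def)
  have odd_power: "(a ^ m) ^ N = a ^ N" if "a \<noteq> 0" "odd m" for a :: 'a and m
  proof -
    from \<open>odd m\<close> obtain r where "m = 2 * r + 1" by (elim oddE)
    hence "(a ^ m) ^ N = (a ^ (N * 2)) ^ r * a ^ N"
      by (simp add: algebra_simps flip: power_mult power_add)
    thus ?thesis using finite_field_power_card_minus_1[OF \<open>a \<noteq> 0\<close>] by (simp add: NN)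
  qed

  \<comment> \<open>Fibres of the sums over \<open>a\<close>-translates\<close>
  have "gapn G"
    unfolding gapn_def char
  proof (intro allI impI)
    fix a b :: 'a assume a: "a \<noteq> 0"
    define t where "t Z = Z ^ p - Z" for Z :: 'a
    define c :: 'a where "c = - of_nat (k choose (p - 1 - l))"
    define e where "e = k + l - (p - 1)"
    define T where "T X = (\<Sum>i\<in>\<int>. G (X + i * a))" for X
    have "c \<in> \<int>" by (simp add: c_def)
    hence c: "c ^ p = c" using Ints_power_CHAR[of c] by (simp add: char)
    have t: "t Z ^ p = - t Z" for Z
      using finite_field_power_card_eq_same[of Z]
      by (simp add: t_def frob_diff assms(3) power2_eq_square power_mult)
    \<comment> \<open>Writing \<open>X = a * Z\<close> turns translation by multiples of
      \<open>a\<close> into translation by the prime field.\<close>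
    have T: "T (a * Z) = - (a ^ (2 * p - 1) * t Z) + u * a ^ (k * p + l) * (c * t Z ^ e)" for Z
    proof -
      have s1: "(\<Sum>i\<in>\<int>. (Z + i) ^ (2 * p - 1)) = - t Z"
        unfolding exp1 using sum_power_two_digits_Ints[of 1 "p - 1" Z] p3
        by (simp add: char t_def)
      have s2: "(\<Sum>i\<in>\<int>. (Z + i) ^ (k * p + l)) = c * t Z ^ e"
        using sum_power_two_digits_Ints[of k l Z] kl kl_lt
        by (simp add: char t_def c_def e_def)
      have "G (a * Z + i * a) = a ^ (2 * p - 1) * (Z + i) ^ (2 * p - 1)
          + u * a ^ (k * p + l) * (Z + i) ^ (k * p + l)" for i
      proof -
        have "a * Z + i * a = a * (Z + i)" by (simp add: algebra_simps)
        thus ?thesis by (simp only: G_def power_mult_distrib mult.assoc)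
      qed
      hence "T (a * Z) = a ^ (2 * p - 1) * (\<Sum>i\<in>\<int>. (Z + i) ^ (2 * p - 1))
          + u * a ^ (k * p + l) * (\<Sum>i\<in>\<int>. (Z + i) ^ (k * p + l))"
        by (simp add: T_def sum.distrib sum_distrib_left)
      thus ?thesis by (simp only: s1 s2 mult_minus_right)
    qed
    have t_eq: "t Y = t Z" if eq: "T (a * Y) = T (a * Z)" for Y Z
    proof (rule ccontr)
      assume ne: "t Y \<noteq> t Z"
      define g where "g = c * (t Y ^ e - t Z ^ e) / (t Y - t Z)"
      have "a ^ (2 * p - 1) * (t Y - t Z) = u * a ^ (k * p + l) * (c * (t Y ^ e - t Z ^ e))"
        using eq unfolding T by (simp add: algebra_simps)
      hence ag: "a ^ (2 * p - 1) = u * a ^ (k * p + l) * g"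
        using ne by (simp add: g_def field_simps)
      hence g0: "g \<noteq> 0" using a by auto
      \<comment> \<open>This rules out truncation in \<open>e\<close>: \<open>k + l < p - 1\<close>
        would force \<open>c = 0\<close>, and \<open>k + l = p - 1\<close> has the wrong
        parity.\<close>
      have "k + l \<ge> p"
      proof (rule ccontr)
        assume "\<not> k + l \<ge> p"
        moreover have "k + l \<noteq> p - 1" using assms(7) even_p by metis
        ultimately have "k < p - 1 - l" by linarith
        hence "c = 0" by (simp add: c_def binomial_eq_0)
        thus False using g0 by (simp add: g_def)
      qed
      hence "e + (p - 1) = k + l" by (simp add: e_def)
      hence "odd e" using assms(7) even_p by (metis even_add)
      hence "(t W ^ e) ^ p = - (t W ^ e)" for W
        using t[of W] by (metis mult.commute power_mult power_minus_odd)
      hence "(t Y ^ e - t Z ^ e) ^ p = - (t Y ^ e - t Z ^ e)"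
        and "(t Y - t Z) ^ p = - (t Y - t Z)"
        by (simp_all add: frob_diff t)
      \<comment> \<open>Frobenius negates numerator and denominator of the quotient and fixes
        \<open>c\<close>.\<close>
      hence "g ^ p = g"
        unfolding g_def power_divide power_mult_distrib c
        by (simp only: mult_minus_right minus_divide_divide)
      hence "g ^ (p - 1) = 1" using g0 p3 by (simp add: power_eq_self_iff)
      hence gN: "g ^ N = 1" by (simp add: N_def power_mult)
      \<comment> \<open>Taking \<open>N\<close>-th powers in \<open>ag\<close> removes
        \<open>g\<close> and makes both odd powers of \<open>a\<close> contribute the same
        \<open>a ^ N\<close>.\<close>
      have "odd (2 * p - 1)" "odd (k * p + l)" using assms(2,7) p3 by auto
      with arg_cong[OF ag, of "\<lambda>x. x ^ N"] have "a ^ N = u ^ N * a ^ N"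
        by (simp add: power_mult_distrib odd_power a gN)
      thus False using uN a by simp
    qed
    show "card {X. (\<Sum>i\<in>\<int>. G (X + i * a)) = b} \<le> p"
    proof (cases "\<exists>Y. T (a * Y) = b")
      case True
      then obtain Y where Y: "T (a * Y) = b" by blast
      \<comment> \<open>Equal values of \<open>t\<close> mean that \<open>X / a - Y\<close> is fixed
        by Frobenius, which leaves at most \<open>p\<close> choices.\<close>
      have "{X. T X = b} \<subseteq> (\<lambda>z. a * (Y + z)) ` {z. z ^ p = z}"
      proof
        fix X assume "X \<in> {X. T X = b}"
        hence "T (a * (X / a)) = T (a * Y)" using a Y by simp
        hence "t (X / a) = t Y" by (rule t_eq)
        hence "(X / a - Y) ^ p = X / a - Y"
          unfolding frob_diff by (simp add: t_def algebra_simps)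
        thus "X \<in> (\<lambda>z. a * (Y + z)) ` {z. z ^ p = z}"
          using a by (intro image_eqI[of _ _ "X / a - Y"]) auto
      qed
      hence "card {X. T X = b} \<le> card {z::'a. z ^ p = z}"
        by (rule surj_card_le[rotated]) simp
      also have "\<dots> \<le> p" using p3 by (intro card_power_eq_self_le) simp
      finally show ?thesis by (simp add: T_def)
    next
      case False
      have "T X \<noteq> b" for X
        using False a by (metis nonzero_mult_div_cancel_left times_divide_eq_right)
      thus ?thesis by (simp add: T_def)
    qed
  qed

  \<comment> \<open>Exponents in the representing polynomial\<close>
  moreover have "algebraic_degree G = max p (k + l)"
  proof -
    define P where "P = monom 1 (2 * p - 1) + monom u (k * p + l)"
    have "(k + 1) * p \<le> p * p" using kl by (intro mult_right_mono) auto
    moreover have "2 * p \<le> p * p" using p3 by (intro mult_right_mono) auto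
    ultimately have bound: "k * p + l \<le> CARD('a) - 1" "2 * p - 1 \<le> CARD('a) - 1"
      using kl unfolding assms(3) power2_eq_square add_mult_distrib by linarith+
    have "repr_poly G = P"
    proof (rule repr_poly_eqI)
      show "degree P \<le> CARD('a) - 1"
        unfolding P_def using bound
        by (intro degree_add_le order.trans[OF degree_monom_le])
    qed (simp add: P_def G_def poly_monom)
    \<comment> \<open>When \<open>k * p + l = 2 * p - 1\<close> the monomials merge with coefficient
      \<open>1 + u\<close>, which must not vanish; \<open>- 1\<close> has too small an order to be
      primitive.\<close>
    moreover have "u \<noteq> - 1"
    proof
      assume "u = - 1"
      hence "u ^ 2 = 1" by simp
      moreover have "4 < CARD('a)"
        using power_mono[of 3 p 2] p3 by (simp add: assms(3))
      ultimately show False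
        using primitive_element_power_neq_1[OF assms(4), of 2] by simp
    qed
    hence "1 + u \<noteq> 0" by (metis add.commute add_eq_0_iff)
    hence "{m \<in> {0..CARD('a) - 1}. coeff P m \<noteq> 0} = {2 * p - 1, k * p + l}"
      using bound u0 by (auto simp: P_def)
    moreover have "digit_sum p (2 * p - 1) = p"
      unfolding exp1 using p3 by (subst digit_sum_two_digits) auto
    moreover have "digit_sum p (k * p + l) = k + l"
      using p3 kl by (intro digit_sum_two_digits) auto
    ultimately show ?thesis by (simp add: algebraic_degree_def char)
  qed
  ultimately show ?thesis by blast
qed

end
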